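(* Let $G$ be a graph and let $t$ be a positive integer. Then $\operatorname{th}_{\operatorname{Z}}(G) \leq t$ if and only if there exist integers $a \geq 1$ and $b \geq 0$ such that $a+b=t$ and $G$ can be obtained (up to isomorphism) from the Cartesian product $K_a \square P_{b+1}$ by contracting path edges and deleting complete edges.
   Context: All graphs are finite, simple, undirected, with nonempty vertex set. $K_a$ is the complete graph on $a$ vertices and $P_{b+1}$ is the path on $b+1$ vertices. The path edges of $K_a\square P_{b+1}$ are the edges lying in the copies of $P_{b+1}$ in the Cartesian product; the complete edges are the edges lying in the copies of $K_a$. "Obtained by contracting path edges and deleting complete edges" means: delete a (possibly empty) set of complete edges and contract a (possibly empty) set of path edges (parallel edges arising are merged so that the graph stays simple); no path edges and no vertices are deleted. Standard zero forcing ($\operatorname{Z}$): each vertex of $G$ is blue or white; a blue vertex $u$ can force a white vertex $w$ to become blue (written $u\to w$) if $w$ is the only white neighbor of $u$. For $B\subseteq V(G)$, color $B$ blue and $V(G)\setminus B$ white, and apply the rule repeatedly, one force at a time, until no longer possible; the unordered set $\mathcal F$ of forces performed is called a set of $\operatorname{Z}$ forces of $B$. Put $\mathcal F^{(0)}=B$, and for $t\ge 0$ let $\mathcal F^{(t+1)}$ be the set of (white) vertices $w$ such that some force $v\to w$ is in $\mathcal F$ and $v$ can force $w$ by the rule when exactly the vertices in $\bigcup_{i=0}^t\mathcal F^{(i)}$ are blue. The propagation time $\operatorname{pt}_{\operatorname{Z}}(G;\mathcal F)$ is the least $t'$ with $V(G)=\bigcup_{i=0}^{t'}\mathcal F^{(i)}$,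 and is $\infty$ if the forces in $\mathcal F$ do not color all of $V(G)$ blue. Define $\operatorname{pt}_{\operatorname{Z}}(G;B)$ as the minimum of $\operatorname{pt}_{\operatorname{Z}}(G;\mathcal F)$ over all sets $\mathcal F$ of $\operatorname{Z}$ forces of $B$, $\operatorname{th}_{\operatorname{Z}}(G;B)=|B|+\operatorname{pt}_{\operatorname{Z}}(G;B)$, and $\operatorname{th}_{\operatorname{Z}}(G)=\min_{B\subseteq V(G)}\operatorname{th}_{\operatorname{Z}}(G;B)$. *)

theory Defs
  imports Main "HOL-Library.Extended_Nat"
begin

section \<open>Finite simple graphs\<close>

datatype 'a graph = Graph (verts: "'a set") (edges: "'a set set")

definition simple_graph :: "'a graph \<Rightarrow> bool" where
  "simple_graph G \<longleftrightarrow>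
     finite (verts G) \<and> verts G \<noteq> {} \<and> edges G \<subseteq> {e. e \<subseteq> verts G \<and> card e = 2}"

definition nbhd :: "'a graph \<Rightarrow> 'a \<Rightarrow> 'a set" where
  "nbhd G u = {v. {u, v} \<in> edges G}"

definition graph_isomorphic :: "'a graph \<Rightarrow> 'b graph \<Rightarrow> bool" where
  "graph_isomorphic G H \<longleftrightarrow>
     (\<exists>f. bij_betw f (verts G) (verts H) \<and>
          (\<forall>u\<in>verts G. \<forall>v\<in>verts G. {u, v} \<in> edges G \<longleftrightarrow> {f u, f v} \<in> edges H))"

definition complete_graph :: "nat \<Rightarrow> nat graph" where
  "complete_graph n = Graph {..<n} {e. e \<subseteq> {..<n} \<and> card e = 2}"

definition path_graph :: "nat \<Rightarrow> nat graph" where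
  "path_graph n = Graph {..<n} {{i, Suc i} | i. Suc i < n}"

section \<open>Cartesian product, deletion and contraction\<close>

text \<open>The edges of the product lying in the copies of the first, respectively second, factor:
  for an edge \<open>e = {x, x'}\<close> the set \<open>e \<times> {y}\<close> is the pair \<open>{(x, y), (x', y)}\<close>.\<close>

definition fst_factor_edges :: "'a graph \<Rightarrow> 'b graph \<Rightarrow> ('a \<times> 'b) set set" where
  "fst_factor_edges G H = {e \<times> {y} | e y. e \<in> edges G \<and> y \<in> verts H}"

definition snd_factor_edges :: "'a graph \<Rightarrow> 'b graph \<Rightarrow> ('a \<times> 'b) set set" where
  "snd_factor_edges G H = {{x} \<times> e | x e. x \<in> verts G \<and> e \<in> edges H}"

definition cartesian_product :: "'a graph \<Rightarrow> 'b graph \<Rightarrow> ('a \<times> 'b) graph" where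
  "cartesian_product G H =
     Graph (verts G \<times> verts H) (fst_factor_edges G H \<union> snd_factor_edges G H)"

definition delete_edges :: "'a graph \<Rightarrow> 'a set set \<Rightarrow> 'a graph" where
  "delete_edges G D = Graph (verts G) (edges G - D)"

text \<open>Contraction of a set \<open>S\<close> of edges of \<open>G\<close>: the new vertices are the classes of vertices
  joined by walks in \<open>S\<close>. Edges are sets of classes, so parallel edges are merged, and an edge
  inside one class disappears.\<close>

definition contraction_rel :: "'a set set \<Rightarrow> ('a \<times> 'a) set" where
  "contraction_rel S = {(u, v). {u, v} \<in> S}\<^sup>*"

definition contract_edges :: "'a graph \<Rightarrow> 'a set set \<Rightarrow> 'a set graph" where
  "contract_edges G S =
     (let W = verts G // contraction_rel S
      in Graph W {{C, D} | C D. C \<in> W \<and> D \<in> W \<and> C \<noteq> D \<and>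
                                (\<exists>u\<in>C. \<exists>v\<in>D. {u, v} \<in> edges G)})"

definition complete_edges :: "nat \<Rightarrow> nat \<Rightarrow> (nat \<times> nat) set set" where
  "complete_edges a b = fst_factor_edges (complete_graph a) (path_graph (b + 1))"

definition path_edges :: "nat \<Rightarrow> nat \<Rightarrow> (nat \<times> nat) set set" where
  "path_edges a b = snd_factor_edges (complete_graph a) (path_graph (b + 1))"

text \<open>Deleting first loses no generality: deleting a merged edge after the contraction amounts
  to deleting beforehand all complete edges merged into it.\<close>

definition obtainable :: "'a graph \<Rightarrow> nat \<Rightarrow> nat \<Rightarrow> bool" where
  "obtainable G a b \<longleftrightarrow>
     (\<exists>D S. D \<subseteq> complete_edges a b \<and> S \<subseteq> path_edges a b \<and>
        graph_isomorphic G
          (contract_edges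
             (delete_edges (cartesian_product (complete_graph a) (path_graph (b + 1))) D) S))"

section \<open>Zero forcing, propagation time and throttling\<close>

definition can_force :: "'a graph \<Rightarrow> 'a set \<Rightarrow> 'a \<Rightarrow> 'a \<Rightarrow> bool" where
  "can_force G Bl u w \<longleftrightarrow> u \<in> Bl \<and> nbhd G u - Bl = {w}"

text \<open>\<open>forcing_run G B Bl F\<close>: starting from \<open>B\<close>, performing the forces in \<open>F\<close> one at a time in
  some valid order leads to the blue set \<open>Bl\<close>.\<close>

inductive forcing_run :: "'a graph \<Rightarrow> 'a set \<Rightarrow> 'a set \<Rightarrow> ('a \<times> 'a) set \<Rightarrow> bool"
  for G :: "'a graph" and B :: "'a set" where
  start: "forcing_run G B B {}"
| step: "forcing_run G B Bl F \<Longrightarrow> can_force G Bl u w \<Longrightarrow>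
           forcing_run G B (insert w Bl) (insert (u, w) F)"

definition set_of_forces :: "'a graph \<Rightarrow> 'a set \<Rightarrow> ('a \<times> 'a) set \<Rightarrow> bool" where
  "set_of_forces G B F \<longleftrightarrow>
     (\<exists>Bl. forcing_run G B Bl F \<and> (\<nexists>u w. can_force G Bl u w))"

fun force_level :: "'a graph \<Rightarrow> 'a set \<Rightarrow> ('a \<times> 'a) set \<Rightarrow> nat \<Rightarrow> 'a set" where
  "force_level G B F 0 = B"
| "force_level G B F (Suc t) =
     {w. \<exists>v. (v, w) \<in> F \<and> can_force G (\<Union>i\<in>{..t}. force_level G B F i) v w}"

definition pt_forces :: "'a graph \<Rightarrow> 'a set \<Rightarrow> ('a \<times> 'a) set \<Rightarrow> enat" where
  "pt_forces G B F =
     (if \<exists>t. verts G = (\<Union>i\<in>{..t}. force_level G B F i)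
      then enat (LEAST t. verts G = (\<Union>i\<in>{..t}. force_level G B F i))
      else \<infinity>)"

text \<open>The infima below are minima, since \<open>enat\<close> is well-ordered and, for a finite graph, the
  index sets are nonempty.\<close>

definition pt_Z :: "'a graph \<Rightarrow> 'a set \<Rightarrow> enat" where
  "pt_Z G B = (INF F\<in>{F. set_of_forces G B F}. pt_forces G B F)"

definition th_Z_set :: "'a graph \<Rightarrow> 'a set \<Rightarrow> enat" where
  "th_Z_set G B = enat (card B) + pt_Z G B"

definition th_Z :: "'a graph \<Rightarrow> enat" where
  "th_Z G = (INF B\<in>Pow (verts G). th_Z_set G B)"

end

theory Submission
  imports Defs
begin

text \<open>Both sides are equivalent to an intermediate notion. On the forcing side, record for every
  vertex \<open>v\<close> the time \<open>\<tau> v\<close> at which it turns blue and, if \<open>\<tau> v > 0\<close>, the vertex \<open>p v\<close> that forces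
  it; the only constraint is that \<open>p v\<close> and all its other neighbours are blue before time \<open>\<tau> v\<close>.
  On the product side, the quotient map onto \<open>G\<close> is a map \<open>\<phi>\<close> on the \<open>a \<times> (b + 1)\<close> grid whose fibres
  are intervals of rows. One passes from \<open>\<phi>\<close> to \<open>\<tau>\<close> by taking the left endpoint of a fibre, and
  from \<open>\<tau>\<close> to \<open>\<phi>\<close> by letting \<open>\<phi> (i, c)\<close> be the end at time \<open>c\<close> of the forcing chain starting at
  the \<open>i\<close>-th initially blue vertex.\<close>

section \<open>The two intermediate notions\<close>

definition schedule :: "'a graph \<Rightarrow> ('a \<Rightarrow> nat) \<Rightarrow> ('a \<Rightarrow> 'a) \<Rightarrow> bool" where
  "schedule G \<tau> p \<longleftrightarrow>
     (\<forall>w\<in>verts G. \<tau> w > 0 \<longrightarrow>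
        {p w, w} \<in> edges G \<and> \<tau> (p w) < \<tau> w \<and>
        (\<forall>x. {p w, x} \<in> edges G \<longrightarrow> x \<noteq> w \<longrightarrow> \<tau> x < \<tau> w))"

definition initial :: "'a graph \<Rightarrow> ('a \<Rightarrow> nat) \<Rightarrow> 'a set" where
  "initial G \<tau> = {v \<in> verts G. \<tau> v = 0}"

text \<open>First coordinates index the copies of the path, second coordinates the columns
  \<open>0\<close> to \<open>b\<close>. The clauses mirror the permitted operations: contracting
  path edges merges only consecutive cells of one row, and an uncontracted path edge must survive.
  Nothing forces a complete edge to survive, since those may be deleted; the last clause only says
  that no edge of \<open>G\<close> comes from elsewhere.\<close>

definition grid_model :: "'a graph \<Rightarrow> nat \<Rightarrow> nat \<Rightarrow> (nat \<times> nat \<Rightarrow> 'a) \<Rightarrow> bool" where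
  "grid_model G a b \<phi> \<longleftrightarrow>
     \<phi> ` ({..<a} \<times> {..b}) = verts G \<and>
     (\<forall>i<a. \<forall>j<a. \<forall>c\<le>b. \<forall>d\<le>b. \<phi> (i, c) = \<phi> (j, d) \<longrightarrow> i = j) \<and>
     (\<forall>i<a. \<forall>d\<le>b. \<forall>c\<le>d. \<phi> (i, c) = \<phi> (i, d) \<longrightarrow> (\<forall>e. c \<le> e \<longrightarrow> e \<le> d \<longrightarrow> \<phi> (i, e) = \<phi> (i, d))) \<and>
     (\<forall>i<a. \<forall>c<b. \<phi> (i, c) = \<phi> (i, Suc c) \<or> {\<phi> (i, c), \<phi> (i, Suc c)} \<in> edges G) \<and>
     (\<forall>u v. {u, v} \<in> edges G \<longrightarrow>
        (\<exists>i<a. \<exists>c<b. {u, v} = {\<phi> (i, c), \<phi> (i, Suc c)}) \<or>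
        (\<exists>i<a. \<exists>j<a. \<exists>c\<le>b. i \<noteq> j \<and> {u, v} = {\<phi> (i, c), \<phi> (j, c)}))"

lemma grid_modelD:
  assumes "grid_model G a b \<phi>"
  shows "\<phi> ` ({..<a} \<times> {..b}) = verts G"
    and "\<phi> (i, c) = \<phi> (j, d) \<Longrightarrow> i < a \<Longrightarrow> j < a \<Longrightarrow> c \<le> b \<Longrightarrow> d \<le> b \<Longrightarrow> i = j"
    and "\<phi> (i, c) = \<phi> (i, d) \<Longrightarrow> i < a \<Longrightarrow> d \<le> b \<Longrightarrow> c \<le> e \<Longrightarrow> e \<le> d \<Longrightarrow> \<phi> (i, e) = \<phi> (i, d)"
    and "i < a \<Longrightarrow> c < b \<Longrightarrow> \<phi> (i, c) = \<phi> (i, Suc c) \<or> {\<phi> (i, c), \<phi> (i, Suc c)} \<in> edges G"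
    and "{u, v} \<in> edges G \<Longrightarrow>
      (\<exists>i<a. \<exists>c<b. {u, v} = {\<phi> (i, c), \<phi> (i, Suc c)}) \<or>
      (\<exists>i<a. \<exists>j<a. \<exists>c\<le>b. i \<noteq> j \<and> {u, v} = {\<phi> (i, c), \<phi> (j, c)})"
proof -
  note gm = assms[unfolded grid_model_def]
  show "\<phi> ` ({..<a} \<times> {..b}) = verts G" by (rule gm[THEN conjunct1])
  show "i = j" if "\<phi> (i, c) = \<phi> (j, d)" "i < a" "j < a" "c \<le> b" "d \<le> b"
    using gm[THEN conjunct2, THEN conjunct1] that by blast
  show "\<phi> (i, e) = \<phi> (i, d)"
    if h: "\<phi> (i, c) = \<phi> (i, d)" "i < a" "d \<le> b" "c \<le> e" "e \<le> d"
    using gm[THEN conjunct2, THEN conjunct2, THEN conjunct1, rule_format, OF h(2,3) _ h(1,4,5)] h(4,5)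
    by simp
  show "\<phi> (i, c) = \<phi> (i, Suc c) \<or> {\<phi> (i, c), \<phi> (i, Suc c)} \<in> edges G" if "i < a" "c < b"
    using gm[THEN conjunct2, THEN conjunct2, THEN conjunct2, THEN conjunct1] that by blast
  show "(\<exists>i<a. \<exists>c<b. {u, v} = {\<phi> (i, c), \<phi> (i, Suc c)}) \<or>
      (\<exists>i<a. \<exists>j<a. \<exists>c\<le>b. i \<noteq> j \<and> {u, v} = {\<phi> (i, c), \<phi> (j, c)})" if "{u, v} \<in> edges G"
    by (rule gm[THEN conjunct2, THEN conjunct2, THEN conjunct2, THEN conjunct2, rule_format, OF that])
qed

lemma edge_verts:
  assumes "simple_graph G" "{u, v} \<in> edges G"
  shows "u \<in> verts G" "v \<in> verts G" "u \<noteq> v"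
proof -
  have "{u, v} \<subseteq> verts G" "card {u, v} = 2"
    using assms unfolding simple_graph_def by blast+
  then show "u \<in> verts G" "v \<in> verts G" "u \<noteq> v" by auto
qed

lemma schedule_edge:
  "schedule G \<tau> p \<Longrightarrow> w \<in> verts G \<Longrightarrow> \<tau> w > 0 \<Longrightarrow> {p w, w} \<in> edges G"
  unfolding schedule_def by blast

lemma schedule_less:
  "schedule G \<tau> p \<Longrightarrow> w \<in> verts G \<Longrightarrow> \<tau> w > 0 \<Longrightarrow> \<tau> (p w) < \<tau> w"
  unfolding schedule_def by blast

lemma schedule_neighbour:
  "schedule G \<tau> p \<Longrightarrow> w \<in> verts G \<Longrightarrow> \<tau> w > 0 \<Longrightarrow> {p w, x} \<in> edges G \<Longrightarrow> x \<noteq> w \<Longrightarrow> \<tau> x < \<tau> w"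
  unfolding schedule_def by blast

text \<open>If \<open>w\<close> and \<open>w'\<close> differed, each would be a further neighbour of
  the common forcer and hence strictly earlier than the other. So forcing chains do not
  branch.\<close>

lemma schedule_inj:
  assumes "schedule G \<tau> p" "w \<in> verts G" "\<tau> w > 0" "w' \<in> verts G" "\<tau> w' > 0" "p w = p w'"
  shows "w = w'"
  using assms schedule_edge schedule_neighbour by (metis less_asym)

section \<open>Zero forcing and schedules\<close>

text \<open>The neighbours of \<open>p w\<close> other than \<open>w\<close> have earlier times, so
  they lie in \<open>X\<close> and \<open>w\<close> is the only white one. The blue set
  \<open>X\<close> is arbitrary because it stands both for a stage of a one-at-a-time run and for a
  union of force levels.\<close>

lemma schedule_can_force:
  assumes "schedule G \<tau> p" "w \<in> verts G" "\<tau> w > 0" "w \<notin> X" "p w \<in> X"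
    and "\<And>x. {p w, x} \<in> edges G \<Longrightarrow> \<tau> x < \<tau> w \<Longrightarrow> x \<in> X"
  shows "can_force G X (p w) w"
proof -
  have "nbhd G (p w) - X \<subseteq> {w}"
    using assms(6) schedule_neighbour[OF assms(1-3)] unfolding nbhd_def by blast
  moreover have "w \<in> nbhd G (p w) - X"
    using schedule_edge[OF assms(1-3)] assms(4) unfolding nbhd_def by blast
  ultimately show ?thesis using assms(5) unfolding can_force_def by blast
qed

text \<open>Simultaneous forces have to be put into a sequence. A vertex \<open>w\<close> of maximal
  time is removed from \<open>X\<close>; what remains is still closed under earlier times and
  contains everything earlier than \<open>w\<close>, so \<open>w\<close> can be forced last.
  Allowing every such closed \<open>X\<close> makes the induction go through.\<close>

lemma schedule_forcing_run:
  assumes G: "simple_graph G" and sch: "schedule G \<tau> p"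
    and "initial G \<tau> \<subseteq> X" "X \<subseteq> verts G"
    and "\<And>w u. w \<in> X - initial G \<tau> \<Longrightarrow> u \<in> verts G \<Longrightarrow> \<tau> u < \<tau> w \<Longrightarrow> u \<in> X"
  shows "forcing_run G (initial G \<tau>) X ((\<lambda>w. (p w, w)) ` (X - initial G \<tau>))"
  using assms(3-5)
proof (induction "card (X - initial G \<tau>)" arbitrary: X)
  case 0
  have "finite (verts G)" using G unfolding simple_graph_def by blast
  then have "finite X" using 0 finite_subset by blast
  then have "X = initial G \<tau>" using 0 by auto
  then show ?case by (simp add: forcing_run.start)
next
  case (Suc n)
  let ?B = "initial G \<tau>"
  have "finite (verts G)" using G unfolding simple_graph_def by blast
  then have fin: "finite (X - ?B)" using Suc.prems finite_subset by blast
  moreover have "X - ?B \<noteq> {}" using Suc.hyps(2) by (metis card.empty nat.distinct(1))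
  ultimately have "Max (\<tau> ` (X - ?B)) \<in> \<tau> ` (X - ?B)" by (intro Max_in) auto
  then obtain w where "w \<in> X - ?B" "Max (\<tau> ` (X - ?B)) = \<tau> w" by blast
  then have w: "w \<in> X - ?B" "\<And>x. x \<in> X - ?B \<Longrightarrow> \<tau> x \<le> \<tau> w"
    using fin Max_ge[of "\<tau> ` (X - ?B)"] by auto
  have wV: "w \<in> verts G" "\<tau> w > 0" using w Suc.prems unfolding initial_def by auto
  let ?Y = "X - {w}"
  have eq: "?Y - ?B = (X - ?B) - {w}" by blast
  have "n = card (?Y - ?B)" using eq Suc.hyps(2) fin w(1) by simp
  then have run: "forcing_run G ?B ?Y ((\<lambda>w. (p w, w)) ` (?Y - ?B))"
  proof (rule Suc.hyps(1))
    show "?B \<subseteq> ?Y" using Suc.prems w by blast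
    show "?Y \<subseteq> verts G" using Suc.prems by blast
    fix x u assume "x \<in> ?Y - ?B" "u \<in> verts G" "\<tau> u < \<tau> x"
    then show "u \<in> ?Y" using w(2)[of x] Suc.prems(3)[of x u] by auto
  qed
  have Y: "u \<in> ?Y" if "u \<in> verts G" "\<tau> u < \<tau> w" for u
    using that Suc.prems(3)[OF w(1), of u] by auto
  have "can_force G ?Y (p w) w"
  proof (rule schedule_can_force[OF sch wV])
    show "p w \<in> ?Y"
      by (rule Y[OF edge_verts(1)[OF G schedule_edge[OF sch wV]] schedule_less[OF sch wV]])
    show "x \<in> ?Y" if "{p w, x} \<in> edges G" "\<tau> x < \<tau> w" for x
      using Y edge_verts(2)[OF G] that by blast
  qed simp
  then have "forcing_run G ?B (insert w ?Y) (insert (p w, w) ((\<lambda>w. (p w, w)) ` (?Y - ?B)))"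
    by (rule forcing_run.step[OF run])
  moreover have "insert w ?Y = X"
    and "insert (p w, w) ((\<lambda>w. (p w, w)) ` (?Y - ?B)) = (\<lambda>w. (p w, w)) ` (X - ?B)"
    using w(1) by blast+
  ultimately show ?case by simp
qed

lemma force_level_verts:
  assumes "simple_graph G" "B \<subseteq> verts G"
  shows "force_level G B F s \<subseteq> verts G"
proof (cases s)
  case 0
  then show ?thesis using assms by simp
next
  case (Suc n)
  then show ?thesis using edge_verts(2)[OF assms(1)] by (auto simp: can_force_def nbhd_def)
qed

text \<open>The forces \<open>p w \<rightarrow> w\<close> colour every vertex \<open>v\<close> no
  later than round \<open>\<tau> v\<close>. The times need not be the earliest possible ones, as
  only an upper bound on the propagation time is wanted.\<close>

lemma th_Z_le_if_schedule:
  assumes G: "simple_graph G" and sch: "schedule G \<tau> p"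
    and b: "\<And>v. v \<in> verts G \<Longrightarrow> \<tau> v \<le> b"
  shows "th_Z G \<le> enat (card (initial G \<tau>) + b)"
proof -
  let ?B = "initial G \<tau>"
  define F where "F = (\<lambda>w. (p w, w)) ` (verts G - ?B)"
  define U where "U s = (\<Union>i\<in>{..s}. force_level G ?B F i)" for s
  have BV: "?B \<subseteq> verts G" unfolding initial_def by blast
  have "forcing_run G ?B (verts G) F"
    unfolding F_def by (rule schedule_forcing_run[OF G sch BV]) auto
  \<comment> \<open>A set of forces must come from a run that cannot be continued; here nothing is
    left to force.\<close>
  moreover have "\<not> can_force G (verts G) u w" for u w
    using edge_verts(2)[OF G] by (auto simp: can_force_def nbhd_def)
  ultimately have F: "set_of_forces G ?B F" unfolding set_of_forces_def by blast
  have blue: "v \<in> U s" if "v \<in> verts G" "\<tau> v \<le> s" for v s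
    using that
  proof (induction s arbitrary: v)
    case 0
    then show ?case by (simp add: U_def initial_def)
  next
    case (Suc s)
    have USuc: "U (Suc s) = U s \<union> force_level G ?B F (Suc s)"
      unfolding U_def by (auto simp: atMost_Suc simp del: force_level.simps)
    \<comment> \<open>Propagation may run ahead of the schedule. Only if \<open>v\<close> is still
      white after round \<open>s\<close> must \<open>p v\<close> force it in round
      \<open>Suc s\<close>.\<close>
    show ?case
    proof (cases "v \<in> U s")
      case True
      then show ?thesis using USuc by blast
    next
      case False
      then have v: "\<tau> v = Suc s" using Suc by (metis le_SucE)
      then have pos: "\<tau> v > 0" by simp
      note e = schedule_edge[OF sch Suc.prems(1) pos]
      have "can_force G (U s) (p v) v"
        using schedule_can_force[OF sch Suc.prems(1) pos False]
          schedule_less[OF sch Suc.prems(1) pos] edge_verts[OF G] e Suc.IH v by force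
      moreover have "(p v, v) \<in> F" using Suc.prems v by (auto simp: F_def initial_def)
      ultimately have "v \<in> force_level G ?B F (Suc s)" unfolding U_def by auto
      then show ?thesis using USuc by blast
    qed
  qed
  have "U b \<subseteq> verts G" unfolding U_def using force_level_verts[OF G BV] by blast
  then have "verts G = U b" using blue b by blast
  note full = this[unfolded U_def]
  then have "pt_forces G ?B F \<le> enat b"
    unfolding pt_forces_def by (auto intro: Least_le)
  then have "pt_Z G ?B \<le> enat b"
    unfolding pt_Z_def using F by (meson INF_lower2 mem_Collect_eq)
  then have "th_Z_set G ?B \<le> enat (card ?B + b)"
    unfolding th_Z_set_def plus_enat_simps(1)[symmetric] by (rule add_left_mono)
  then show ?thesis
    unfolding th_Z_def using BV by (meson INF_lower2 PowI)
qed

text \<open>Take \<open>\<tau> v\<close> to be the first round after which \<open>v\<close> is blue,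
  and \<open>p v\<close> a vertex that forces it in that round.\<close>

lemma schedule_if_th_Z_le:
  assumes G: "simple_graph G" and th: "th_Z G \<le> enat t"
  obtains \<tau> p b where "schedule G \<tau> p" "\<And>v. v \<in> verts G \<Longrightarrow> \<tau> v \<le> b"
    "card (initial G \<tau>) + b = t"
proof -
  \<comment> \<open>A strict bound on an infimum yields a member below it; this device provides
    first \<open>B\<close> and then \<open>F\<close>.\<close>
  have "th_Z G < enat (Suc t)" using th by (metis enat_ord_simps(2) le_less_trans lessI)
  then obtain B where BV: "B \<subseteq> verts G" and B: "th_Z_set G B < enat (Suc t)"
    unfolding th_Z_def INF_less_iff by blast
  then obtain k where k: "pt_Z G B = enat k" "card B + k \<le> t"
    unfolding th_Z_set_def by (cases "pt_Z G B") auto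
  then have "pt_Z G B < enat (Suc k)" by simp
  then obtain F where F: "pt_forces G B F < enat (Suc k)"
    unfolding pt_Z_def INF_less_iff by blast
  define U where "U s = (\<Union>i\<in>{..s}. force_level G B F i)" for s
  have ex: "\<exists>s. verts G = U s"
  proof -
    have "pt_forces G B F \<noteq> \<infinity>"
    proof
      assume "pt_forces G B F = \<infinity>"
      with F show False by simp
    qed
    then show ?thesis unfolding pt_forces_def U_def by metis
  qed
  define T where "T = (LEAST s. verts G = U s)"
  have VT: "verts G = U T" using ex unfolding T_def by (rule LeastI_ex)
  have "T \<le> k" using F ex unfolding pt_forces_def T_def U_def by (auto split: if_splits)
  define \<tau> where "\<tau> v = (LEAST s. v \<in> U s)" for v
  have \<tau>_le: "\<tau> v \<le> s" if "v \<in> U s" for v s using that unfolding \<tau>_def by (rule Least_le)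
  have \<tau>_in: "v \<in> U (\<tau> v)" if "v \<in> verts G" for v
    using that VT unfolding \<tau>_def by (metis (mono_tags) LeastI)
  have U0: "U 0 = B" unfolding U_def by simp
  have init: "initial G \<tau> = B"
    using BV \<tau>_le[of _ 0] \<tau>_in unfolding initial_def U0 by (force simp: U0)
  \<comment> \<open>By minimality of \<open>\<tau> w\<close>, the vertex is white after the
    preceding round, so it belongs to the force level \<open>\<tau> w\<close>, which is computed
    from the blue set \<open>U (\<tau> w - 1)\<close>.\<close>
  have "\<exists>v. can_force G (U (\<tau> w - 1)) v w" if w: "w \<in> verts G" "\<tau> w > 0" for w
  proof -
    obtain s where s: "\<tau> w = Suc s" using w by (cases "\<tau> w") auto
    have "U (Suc s) = U s \<union> force_level G B F (Suc s)"
      unfolding U_def by (auto simp: atMost_Suc simp del: force_level.simps)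
    moreover have "w \<notin> U s" using \<tau>_le s by fastforce
    ultimately have "w \<in> force_level G B F (Suc s)" using \<tau>_in[OF w(1)] s by auto
    then show ?thesis using s unfolding U_def by auto
  qed
  then obtain p where p: "\<And>w. w \<in> verts G \<Longrightarrow> \<tau> w > 0 \<Longrightarrow> can_force G (U (\<tau> w - 1)) (p w) w"
    by metis
  have "schedule G \<tau> p"
    unfolding schedule_def
  proof (intro ballI impI)
    fix w assume w: "w \<in> verts G" "\<tau> w > 0"
    have earlier: "\<tau> x < \<tau> w" if "x \<in> U (\<tau> w - 1)" for x using \<tau>_le[OF that] w(2) by simp
    show "{p w, w} \<in> edges G \<and> \<tau> (p w) < \<tau> w \<and>
      (\<forall>x. {p w, x} \<in> edges G \<longrightarrow> x \<noteq> w \<longrightarrow> \<tau> x < \<tau> w)"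
      using p[OF w] earlier unfolding can_force_def nbhd_def by blast
  qed
  \<comment> \<open>The bound \<open>t - card B\<close> may exceed the propagation time; it absorbs
    the slack so that the sum is exactly \<open>t\<close>.\<close>
  moreover have "\<tau> v \<le> t - card B" if "v \<in> verts G" for v
    using \<tau>_le[of v T] that VT \<open>T \<le> k\<close> k(2) by simp
  ultimately show ?thesis using that[of \<tau> p "t - card B"] k(2) init by simp
qed

text \<open>A vertex of least time cannot have been forced, because its forcer would be strictly
  earlier.\<close>

lemma schedule_initial_nonempty:
  assumes G: "simple_graph G" and sch: "schedule G \<tau> p"
  shows "card (initial G \<tau>) \<ge> 1"
proof -
  have "\<exists>x. x \<in> verts G" using G unfolding simple_graph_def by blast
  then obtain v where v: "v \<in> verts G" "\<And>u. u \<in> verts G \<Longrightarrow> \<tau> v \<le> \<tau> u"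
    using ex_has_least_nat[of "\<lambda>x. x \<in> verts G" _ \<tau>] by blast
  have "\<tau> v = 0"
    using v schedule_less[OF sch v(1)] schedule_edge[OF sch v(1)] edge_verts(1)[OF G]
    by (metis gr0I leD)
  then have "v \<in> initial G \<tau>" using v by (simp add: initial_def)
  moreover have "finite (initial G \<tau>)" using G by (simp add: initial_def simple_graph_def)
  ultimately show ?thesis by (metis One_nat_def Suc_leI card_gt_0_iff empty_iff)
qed

section \<open>Schedules and grid models\<close>

text \<open>A vertex turns blue in the first column of its fibre and is forced by the vertex just
  before it in the same row.\<close>

lemma schedule_if_grid_model:
  assumes G: "simple_graph G" and gm: "grid_model G a b \<phi>"
  obtains \<tau> p where "schedule G \<tau> p" "\<And>v. v \<in> verts G \<Longrightarrow> \<tau> v \<le> b" "card (initial G \<tau>) = a"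
proof -
  note onto = grid_modelD(1)[OF gm] and row = grid_modelD(2)[OF gm]
    and interval = grid_modelD(3)[OF gm] and step = grid_modelD(4)[OF gm]
    and edge = grid_modelD(5)[OF gm]
  define \<tau> where "\<tau> v = (LEAST c. \<exists>i<a. c \<le> b \<and> \<phi> (i, c) = v)" for v
  have \<tau>_le: "\<tau> (\<phi> (i, c)) \<le> c" if "i < a" "c \<le> b" for i c
    unfolding \<tau>_def using that by (intro Least_le) blast
  have \<tau>_ex: "\<exists>i<a. \<tau> v \<le> b \<and> \<phi> (i, \<tau> v) = v" if "v \<in> verts G" for v
  proof -
    have "\<exists>c. \<exists>i<a. c \<le> b \<and> \<phi> (i, c) = v" using that onto by force
    then show ?thesis unfolding \<tau>_def by (rule LeastI_ex)
  qed
  then obtain r where r: "\<And>v. v \<in> verts G \<Longrightarrow> r v < a \<and> \<tau> v \<le> b \<and> \<phi> (r v, \<tau> v) = v" by metis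
  define p where "p w = \<phi> (r w, \<tau> w - 1)" for w
  have "schedule G \<tau> p"
    unfolding schedule_def
  proof (intro ballI impI)
    fix w assume w: "w \<in> verts G" "\<tau> w > 0"
    obtain c where c: "\<tau> w = Suc c" using w by (cases "\<tau> w") auto
    define i where "i = r w"
    have i: "i < a" "Suc c \<le> b" "\<phi> (i, Suc c) = w" "p w = \<phi> (i, c)"
      using r[OF w(1)] c by (auto simp: i_def p_def)
    have "\<tau> (p w) \<le> c" using \<tau>_le[of i c] i by simp
    then have ne: "p w \<noteq> w" using c by auto
    have e: "{p w, w} \<in> edges G" using step[of i c] i ne by simp
    \<comment> \<open>If \<open>p w\<close> reappeared after column \<open>c\<close>, its fibre,
      being an interval, would contain column \<open>Suc c\<close>, where \<open>w\<close> sits. So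
      all cells of \<open>p w\<close> lie in row \<open>i\<close>, up to column
      \<open>c\<close>.\<close>
    have key: "j = i \<and> d \<le> c" if "\<phi> (j, d) = p w" "j < a" "d \<le> b" for j d
    proof -
      have "j = i" using row[of j d i c] that i by simp
      moreover have "\<not> Suc c \<le> d" using interval[of i c d "Suc c"] that i ne \<open>j = i\<close> by auto
      ultimately show ?thesis by simp
    qed
    have "\<tau> x < \<tau> w" if x: "{p w, x} \<in> edges G" "x \<noteq> w" for x
    proof -
      \<comment> \<open>A complete edge stays within a column, and a path edge can leave the columns
        up to \<open>c\<close> only by stepping from \<open>p w\<close> to \<open>w\<close>.\<close>
      have "\<exists>j<a. \<exists>d\<le>c. x = \<phi> (j, d)"
        using edge[OF x(1)]
      proof (elim disjE exE conjE)
        fix j d assume j: "j < a" "d < b" "{p w, x} = {\<phi> (j, d), \<phi> (j, Suc d)}"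
        then consider "p w = \<phi> (j, d)" "x = \<phi> (j, Suc d)" | "p w = \<phi> (j, Suc d)" "x = \<phi> (j, d)"
          by (metis doubleton_eq_iff)
        then show ?thesis
        proof cases
          case 1
          then have "j = i" "d \<le> c" using key[of j d] j by auto
          moreover have "d \<noteq> c" using 1 x(2) i \<open>j = i\<close> by auto
          ultimately show ?thesis using 1 i(1) by (metis Suc_leI le_neq_implies_less)
        next
          case 2
          then show ?thesis using key[of j "Suc d"] j by (metis Suc_leD Suc_leI)
        qed
      next
        fix j k d assume j: "j < a" "k < a" "d \<le> b" "{p w, x} = {\<phi> (j, d), \<phi> (k, d)}"
        then show ?thesis using key[of j d] key[of k d] by (metis doubleton_eq_iff)
      qed
      then obtain j d where "j < a" "d \<le> c" "x = \<phi> (j, d)" by blast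
      then show ?thesis using \<tau>_le[of j d] c i(2) by simp
    qed
    then show "{p w, w} \<in> edges G \<and> \<tau> (p w) < \<tau> w \<and>
      (\<forall>x. {p w, x} \<in> edges G \<longrightarrow> x \<noteq> w \<longrightarrow> \<tau> x < \<tau> w)"
      using e \<open>\<tau> (p w) \<le> c\<close> c by auto
  qed
  moreover have "card (initial G \<tau>) = a"
  proof -
    \<comment> \<open>The vertices of time \<open>0\<close> are those of column \<open>0\<close>,
      one for each row.\<close>
    have "initial G \<tau> = (\<lambda>i. \<phi> (i, 0)) ` {..<a}"
    proof
      show "initial G \<tau> \<subseteq> (\<lambda>i. \<phi> (i, 0)) ` {..<a}"
        unfolding initial_def using \<tau>_ex by force
      show "(\<lambda>i. \<phi> (i, 0)) ` {..<a} \<subseteq> initial G \<tau>"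
        unfolding initial_def onto[symmetric] using \<tau>_le[of _ 0] by force
    qed
    moreover have "inj_on (\<lambda>i. \<phi> (i, 0)) {..<a}"
      using row[of _ 0 _ 0] by (auto intro!: inj_onI)
    ultimately show ?thesis by (simp add: card_image)
  qed
  ultimately show ?thesis using that r by metis
qed

text \<open>Row \<open>i\<close> follows the forcing chain of the \<open>i\<close>-th initial
  vertex, repeating the current end until it forces the next one.\<close>

lemma grid_model_if_schedule:
  assumes G: "simple_graph G" and sch: "schedule G \<tau> p"
    and b: "\<And>v. v \<in> verts G \<Longrightarrow> \<tau> v \<le> b"
  obtains \<phi> where "grid_model G (card (initial G \<tau>)) b \<phi>"
proof -
  define a where "a = card (initial G \<tau>)"
  have "finite (initial G \<tau>)" using G by (simp add: initial_def simple_graph_def)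
  then obtain \<beta> where \<beta>: "bij_betw \<beta> {..<a} (initial G \<tau>)"
    unfolding a_def using ex_bij_betw_nat_finite[of "initial G \<tau>"] by (auto simp: atLeast0LessThan)
  \<comment> \<open>The vertex forced by \<open>v\<close> at time \<open>Suc c\<close>, with
    \<open>v\<close> itself as default. The choice is harmless, as \<open>schedule_inj\<close>
    leaves at most one candidate.\<close>
  define ext where "ext c v = (if \<exists>w\<in>verts G. \<tau> w = Suc c \<and> p w = v
    then SOME w. w \<in> verts G \<and> \<tau> w = Suc c \<and> p w = v else v)" for c v
  define \<psi> where "\<psi> i = rec_nat (\<beta> i) ext" for i
  have \<psi>0: "\<psi> i 0 = \<beta> i" for i unfolding \<psi>_def by simp
  have \<psi>_ext: "\<psi> i (Suc c) = ext c (\<psi> i c)" for i c unfolding \<psi>_def by simp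
  have \<psi>Suc: "\<psi> i (Suc c) = \<psi> i c \<and> (\<forall>w\<in>verts G. \<tau> w = Suc c \<longrightarrow> p w \<noteq> \<psi> i c) \<or>
      \<psi> i (Suc c) \<in> verts G \<and> \<tau> (\<psi> i (Suc c)) = Suc c \<and> p (\<psi> i (Suc c)) = \<psi> i c" for i c
  proof (cases "\<exists>w\<in>verts G. \<tau> w = Suc c \<and> p w = \<psi> i c")
    case True
    then have "\<exists>w. w \<in> verts G \<and> \<tau> w = Suc c \<and> p w = \<psi> i c" by blast
    moreover have "\<psi> i (Suc c) = (SOME w. w \<in> verts G \<and> \<tau> w = Suc c \<and> p w = \<psi> i c)"
      unfolding \<psi>_ext ext_def by (rule if_P[OF True])
    ultimately show ?thesis by (metis (mono_tags, lifting) someI_ex)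
  next
    case False
    then have "\<psi> i (Suc c) = \<psi> i c" unfolding \<psi>_ext ext_def by (rule if_not_P)
    then show ?thesis using False by blast
  qed
  have \<psi>V: "\<psi> i c \<in> verts G \<and> \<tau> (\<psi> i c) \<le> c" if "i < a" for i c
  proof (induction c)
    case 0
    have "\<beta> i \<in> initial G \<tau>" using \<beta> that by (metis bij_betwE lessThan_iff)
    then show ?case by (simp add: \<psi>0 initial_def)
  next
    case (Suc c)
    then show ?case using \<psi>Suc[of i c] by auto
  qed
  \<comment> \<open>If only one chain grows, its new end has time \<open>Suc c\<close> and the other
    end is older; if both grow to the same vertex, their previous ends are the same forcer.\<close>
  have inj: "i = j" if "i < a" "j < a" "\<psi> i c = \<psi> j c" for i j c
    using that
  proof (induction c)
    case 0
    then show ?case using \<beta> by (auto simp: \<psi>0 bij_betw_def dest: inj_onD)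
  next
    case (Suc c)
    have "\<tau> (\<psi> i c) \<noteq> Suc c" "\<tau> (\<psi> j c) \<noteq> Suc c"
      using \<psi>V[of i c] \<psi>V[of j c] Suc.prems by auto
    then show ?case using \<psi>Suc[of i c] \<psi>Suc[of j c] Suc by metis
  qed
  \<comment> \<open>A chain can enter a new vertex only in the column equal to that vertex's time.
    Hence a vertex of time at most \<open>c\<close> seen in column \<open>d\<close> was already
    there in column \<open>c\<close>.\<close>
  have settled: "\<psi> i c = \<psi> i d" if "i < a" "\<tau> (\<psi> i d) \<le> c" "c \<le> d" for i c d
    using that
  proof (induction d)
    case 0
    then show ?case by simp
  next
    case (Suc d)
    show ?case
    proof (cases "c = Suc d")
      case False
      then have "\<psi> i (Suc d) = \<psi> i d" using \<psi>Suc[of i d] Suc.prems by auto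
      then show ?thesis using Suc False by auto
    qed simp
  qed
  \<comment> \<open>A chain leaves \<open>u\<close> only when \<open>u\<close> forces, so it waits
    while every force by \<open>u\<close> is still to come.\<close>
  have stay: "\<psi> i c = u"
    if "i < a" "\<psi> i d = u" "d \<le> c" "\<And>w. w \<in> verts G \<Longrightarrow> \<tau> w > 0 \<Longrightarrow> p w = u \<Longrightarrow> c < \<tau> w" for i c d u
    using that(3,4)
  proof (induction c rule: dec_induct)
    case base
    then show ?case using that by simp
  next
    case (step c)
    then have "\<psi> i c = u" using Suc_lessD by blast
    then show ?case using \<psi>Suc[of i c] step(4)[of "\<psi> i (Suc c)"] by auto
  qed
  have forced: "\<psi> i (\<tau> w) = w"
    if w: "i < a" "w \<in> verts G" "\<tau> w > 0" "\<psi> i (\<tau> (p w)) = p w" for i w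
  proof -
    obtain c where c: "\<tau> w = Suc c" using w by (cases "\<tau> w") auto
    have "\<psi> i c = p w"
      using w(1,4)
    proof (rule stay)
      show "\<tau> (p w) \<le> c" using schedule_less[OF sch w(2,3)] c by simp
      show "c < \<tau> x" if "x \<in> verts G" "\<tau> x > 0" "p x = p w" for x
        using schedule_inj[OF sch that(1,2) w(2,3) that(3)] c by simp
    qed
    then show ?thesis using \<psi>Suc[of i c] c w(2) schedule_inj[OF sch _ _ w(2,3)]
      by (metis zero_less_Suc)
  qed
  \<comment> \<open>Tracing forcers back strictly lowers the time and ends at an initial vertex,
    whose chain then leads to \<open>v\<close>.\<close>
  have onto: "\<exists>i<a. \<psi> i (\<tau> v) = v" if "v \<in> verts G" for v
    using that
  proof (induction "\<tau> v" arbitrary: v rule: less_induct)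
    case less
    show ?case
    proof (cases "\<tau> v = 0")
      case True
      then have "v \<in> \<beta> ` {..<a}" using \<beta> less by (auto simp: bij_betw_def initial_def)
      then show ?thesis using True by (auto simp: \<psi>0)
    next
      case False
      then have v: "\<tau> v > 0" by simp
      have "p v \<in> verts G" using schedule_edge[OF sch less.prems v] edge_verts(1)[OF G] by blast
      then obtain i where "i < a" "\<psi> i (\<tau> (p v)) = p v"
        using less.hyps schedule_less[OF sch less.prems v] by blast
      then show ?thesis using forced less.prems v by blast
    qed
  qed
  have edge: "(\<exists>i<a. \<exists>c<b. {u, v} = {\<psi> i c, \<psi> i (Suc c)}) \<or>
      (\<exists>i<a. \<exists>j<a. \<exists>c\<le>b. i \<noteq> j \<and> {u, v} = {\<psi> i c, \<psi> j c})"
    if e: "{u, v} \<in> edges G" and le: "\<tau> u \<le> \<tau> v" for u v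
  proof -
    note uv = edge_verts[OF G e]
    obtain i where i: "i < a" "\<psi> i (\<tau> u) = u" using onto uv by blast
    obtain j where j: "j < a" "\<psi> j (\<tau> v) = v" using onto uv by blast
    show ?thesis
    \<comment> \<open>If the chain of \<open>u\<close> still waits at \<open>u\<close> when
      \<open>v\<close> turns blue, both vertices occur in column \<open>\<tau> v\<close> and give a
      complete edge. Otherwise \<open>u\<close> has forced some \<open>w\<close> by then; all other
      neighbours of \<open>u\<close> are earlier than \<open>w\<close>, so \<open>v = w\<close> and
      a path edge results.\<close>
    proof (cases "\<psi> i (\<tau> v) = u")
      case True
      then have "{u, v} = {\<psi> i (\<tau> v), \<psi> j (\<tau> v)}" "i \<noteq> j" using j uv by auto
      then show ?thesis using b[OF uv(2)] i(1) j(1) by blast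
    next
      case False
      then obtain w where w: "w \<in> verts G" "\<tau> w > 0" "p w = u" "\<tau> w \<le> \<tau> v"
        using stay[OF i le] by (meson not_le)
      then have "v = w" using schedule_neighbour[OF sch w(1,2), of v] e by fastforce
      then obtain c where c: "\<tau> v = Suc c" using w by (cases "\<tau> v") auto
      have v: "\<psi> i (Suc c) = v" using forced[OF i(1) w(1,2)] i(2) w(3) \<open>v = w\<close> c by simp
      have "\<psi> i c \<noteq> v" using \<psi>V[OF i(1), of c] c by auto
      then have "u = \<psi> i c" using \<psi>Suc[of i c] v w(3) \<open>v = w\<close> by auto
      then have "{u, v} = {\<psi> i c, \<psi> i (Suc c)}" "c < b" using v b[OF uv(2)] c by auto
      then show ?thesis using i(1) by blast
    qed
  qed
  have "grid_model G a b (\<lambda>(i, c). \<psi> i c)"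
    unfolding grid_model_def prod.case
  proof (intro conjI allI impI)
    show "(\<lambda>(i, c). \<psi> i c) ` ({..<a} \<times> {..b}) = verts G"
    proof (intro equalityI subsetI)
      show "v \<in> verts G" if "v \<in> (\<lambda>(i, c). \<psi> i c) ` ({..<a} \<times> {..b})" for v
        using that \<psi>V by auto
      fix v assume v: "v \<in> verts G"
      then obtain i where "i < a" "\<psi> i (\<tau> v) = v" using onto by blast
      then show "v \<in> (\<lambda>(i, c). \<psi> i c) ` ({..<a} \<times> {..b})"
        using b[OF v] by (intro image_eqI[of _ _ "(i, \<tau> v)"]) auto
    qed
    \<comment> \<open>In the earlier of the two columns both rows already show the common vertex, by
      \<open>settled\<close>; there \<open>inj\<close> applies.\<close>
    fix i j c d assume "i < a" "j < a" "c \<le> b" "d \<le> b" "\<psi> i c = \<psi> j d"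
    then show "i = j"
      using settled[of i c d] settled[of j d c] inj[of i j] \<psi>V[of i c] \<psi>V[of j d] by (metis nat_le_linear)
  next
    fix i c d e assume "i < a" "c \<le> d" "\<psi> i c = \<psi> i d" "c \<le> e" "e \<le> d"
    then show "\<psi> i e = \<psi> i d" using settled[of i d e] \<psi>V[of i c] by auto
  next
    fix i c assume "i < a" "c < b"
    then show "\<psi> i c = \<psi> i (Suc c) \<or> {\<psi> i c, \<psi> i (Suc c)} \<in> edges G"
      using \<psi>Suc[of i c] schedule_edge[OF sch, of "\<psi> i (Suc c)"] by auto
  next
    fix u v assume e: "{u, v} \<in> edges G"
    show "(\<exists>i<a. \<exists>c<b. {u, v} = {\<psi> i c, \<psi> i (Suc c)}) \<or>
      (\<exists>i<a. \<exists>j<a. \<exists>c\<le>b. i \<noteq> j \<and> {u, v} = {\<psi> i c, \<psi> j c})"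
    proof (cases "\<tau> u \<le> \<tau> v")
      case True
      then show ?thesis by (rule edge[OF e])
    next
      case False
      then have "\<tau> v \<le> \<tau> u" by simp
      from edge[OF e[unfolded insert_commute[of u v "{}"]] this]
      show ?thesis unfolding insert_commute[of u v "{}"] .
    qed
  qed
  then show ?thesis using that unfolding a_def by blast
qed

section \<open>Grid models and contractions\<close>

lemma complete_edges_iff:
  "{(i, c), (j, d)} \<in> complete_edges a b \<longleftrightarrow> i \<noteq> j \<and> c = d \<and> i < a \<and> j < a \<and> c \<le> b"
proof
  assume "{(i, c), (j, d)} \<in> complete_edges a b"
  then obtain e y where e: "{(i, c), (j, d)} = e \<times> {y}" "e \<subseteq> {..<a}" "card e = 2" "y < Suc b"
    by (auto simp: complete_edges_def fst_factor_edges_def complete_graph_def path_graph_def)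
  have "e = fst ` (e \<times> {y})" by force
  also have "\<dots> = {i, j}" using e(1)[symmetric] by simp
  finally have ij: "e = {i, j}" .
  then have "i \<noteq> j" using e(3) by auto
  moreover have "(i, c) \<in> e \<times> {y}" "(j, d) \<in> e \<times> {y}" using e(1) by blast+
  ultimately show "i \<noteq> j \<and> c = d \<and> i < a \<and> j < a \<and> c \<le> b" using e ij by auto
next
  assume h: "i \<noteq> j \<and> c = d \<and> i < a \<and> j < a \<and> c \<le> b"
  then have "{(i, c), (j, d)} = {i, j} \<times> {c}" "{i, j} \<subseteq> {..<a}" "card {i, j} = 2" "c < Suc b"
    by auto
  then show "{(i, c), (j, d)} \<in> complete_edges a b"
    unfolding complete_edges_def fst_factor_edges_def complete_graph_def path_graph_def
      graph.sel mem_Collect_eq lessThan_iff Suc_eq_plus1 by blast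
qed

lemma path_edges_iff:
  "{(i, c), (j, d)} \<in> path_edges a b \<longleftrightarrow> i = j \<and> i < a \<and> c \<le> b \<and> d \<le> b \<and> (d = Suc c \<or> c = Suc d)"
proof
  assume "{(i, c), (j, d)} \<in> path_edges a b"
  then obtain x k where e: "{(i, c), (j, d)} = {x} \<times> {k, Suc k}" "x < a" "k < b"
    by (auto simp: path_edges_def snd_factor_edges_def complete_graph_def path_graph_def)
  have "{c, d} = snd ` {(i, c), (j, d)}" by simp
  also have "\<dots> = {k, Suc k}" unfolding e(1) by simp
  finally have "{c, d} = {k, Suc k}" .
  moreover have "(i, c) \<in> {x} \<times> {k, Suc k}" "(j, d) \<in> {x} \<times> {k, Suc k}" using e(1) by blast+
  ultimately show "i = j \<and> i < a \<and> c \<le> b \<and> d \<le> b \<and> (d = Suc c \<or> c = Suc d)"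
    using e(2,3) by (auto simp: doubleton_eq_iff)
next
  assume h: "i = j \<and> i < a \<and> c \<le> b \<and> d \<le> b \<and> (d = Suc c \<or> c = Suc d)"
  define k where "k = min c d"
  have "{(i, c), (j, d)} = {i} \<times> {k, Suc k}" "i < a" "Suc k < b + 1"
    using h by (auto simp: k_def)
  then show "{(i, c), (j, d)} \<in> path_edges a b"
    unfolding path_edges_def snd_factor_edges_def complete_graph_def path_graph_def
      graph.sel mem_Collect_eq lessThan_iff by blast
qed

abbreviation grid :: "nat \<Rightarrow> nat \<Rightarrow> (nat \<times> nat) graph" where
  "grid a b \<equiv> cartesian_product (complete_graph a) (path_graph (b + 1))"

lemma verts_grid: "verts (grid a b) = {..<a} \<times> {..b}"
  by (auto simp: cartesian_product_def complete_graph_def path_graph_def)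

lemma edges_grid: "edges (grid a b) = complete_edges a b \<union> path_edges a b"
  by (simp add: cartesian_product_def complete_edges_def path_edges_def)

section \<open>Classes of contracted path edges\<close>

lemma equiv_contraction_rel: "equiv UNIV (contraction_rel S)"
proof -
  have "sym {(u, v). {u, v} \<in> S}" by (auto simp: sym_def insert_commute)
  then show ?thesis
    unfolding contraction_rel_def equiv_def
    by (simp add: refl_rtrancl sym_rtrancl trans_rtrancl)
qed

text \<open>A walk inside a row cannot jump, so it crosses every edge between its two ends. The
  minimum and maximum allow for either direction.\<close>

lemma contraction_rel_row:
  assumes "S \<subseteq> path_edges a b" "(x, y) \<in> contraction_rel S"
  shows "fst x = fst y \<and>
    (\<forall>e. min (snd x) (snd y) \<le> e \<longrightarrow> e < max (snd x) (snd y) \<longrightarrow> {(fst x, e), (fst x, Suc e)} \<in> S)"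
  using assms(2) unfolding contraction_rel_def
proof (induction rule: rtrancl_induct)
  case base
  then show ?case by simp
next
  case (step y z)
  obtain i c j d where yz: "y = (i, c)" "z = (j, d)" by (meson prod.exhaust)
  have S: "{(i, c), (j, d)} \<in> S" using step yz by simp
  then have e: "i = j" "d = Suc c \<or> c = Suc d" using assms(1) path_edges_iff by blast+
  have "{(i, min c d), (i, Suc (min c d))} \<in> S"
    using e S by (auto simp: insert_commute)
  \<comment> \<open>Moving the end from \<open>c\<close> to its neighbour \<open>d\<close> adds at
    most the edge starting at \<open>min c d\<close>.\<close>
  moreover have "min (snd x) c \<le> k \<and> k < max (snd x) c \<or> k = min c d"
    if "min (snd x) d \<le> k" "k < max (snd x) d" for k
    using that e(2) by linarith
  ultimately show ?case using step.IH yz e(1) by fastforce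
qed

lemma contraction_rel_rowI:
  assumes "c \<le> d" "\<And>e. c \<le> e \<Longrightarrow> e < d \<Longrightarrow> {(i, e), (i, Suc e)} \<in> S"
  shows "((i, c), (i, d)) \<in> contraction_rel S"
  using assms
proof (induction d rule: dec_induct)
  case base
  then show ?case by (simp add: contraction_rel_def)
next
  case (step d)
  then have "((i, c), (i, d)) \<in> contraction_rel S" by simp
  moreover have "{(i, d), (i, Suc d)} \<in> S" using step by simp
  ultimately show ?case unfolding contraction_rel_def by (auto intro: rtrancl_into_rtrancl)
qed

text \<open>The quotient map followed by the inverse of the isomorphism is a grid model; its fibres
  are the contraction classes.\<close>

lemma grid_model_if_obtainable:
  assumes G: "simple_graph G" and "obtainable G a b"
  obtains \<phi> where "grid_model G a b \<phi>"
proof -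
  obtain D S where D: "D \<subseteq> complete_edges a b" and S: "S \<subseteq> path_edges a b"
    and "graph_isomorphic G (contract_edges (delete_edges (grid a b) D) S)"
    using assms(2) unfolding obtainable_def by blast
  then obtain f where
    f: "bij_betw f (verts G) (verts (contract_edges (delete_edges (grid a b) D) S))" and
    fe: "\<And>u v. u \<in> verts G \<Longrightarrow> v \<in> verts G \<Longrightarrow>
      {u, v} \<in> edges G \<longleftrightarrow> {f u, f v} \<in> edges (contract_edges (delete_edges (grid a b) D) S)"
    unfolding graph_isomorphic_def by blast
  define R where "R = contraction_rel S"
  note equiv = equiv_contraction_rel[of S, folded R_def]
  let ?X = "{..<a} \<times> {..b}"
  define W where "W = ?X // R"
  have W: "bij_betw f (verts G) W"
    using f by (simp only: contract_edges_def Let_def W_def R_def delete_edges_def verts_grid graph.sel)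
  have We: "{u, v} \<in> edges G \<longleftrightarrow>
      (\<exists>C D'. {f u, f v} = {C, D'} \<and> C \<in> W \<and> D' \<in> W \<and> C \<noteq> D' \<and>
        (\<exists>x\<in>C. \<exists>y\<in>D'. {x, y} \<in> (complete_edges a b \<union> path_edges a b) - D))"
    if "u \<in> verts G" "v \<in> verts G" for u v
    using fe[OF that]
    by (simp only: contract_edges_def Let_def W_def R_def delete_edges_def verts_grid edges_grid
        graph.sel mem_Collect_eq)
  define \<phi> where "\<phi> x = the_inv_into (verts G) f (R `` {x})" for x
  have \<phi>V: "\<phi> x \<in> verts G \<and> f (\<phi> x) = R `` {x}" if "x \<in> ?X" for x
  proof -
    have "R `` {x} \<in> W" using that unfolding W_def by (rule quotientI)
    then show ?thesis unfolding \<phi>_def using W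
      by (metis bij_betw_def f_the_inv_into_f the_inv_into_into subset_refl)
  qed
  have \<phi>_eq: "\<phi> x = \<phi> y \<longleftrightarrow> (x, y) \<in> R" if "x \<in> ?X" "y \<in> ?X" for x y
    using \<phi>V[OF that(1)] \<phi>V[OF that(2)] equiv_class_eq_iff[OF equiv] \<phi>_def by (metis UNIV_I)
  \<comment> \<open>Edges of the contraction are witnessed by arbitrary representatives of the
    classes, so every cell of the class \<open>f u\<close> has to be identified with
    \<open>u\<close>.\<close>
  have \<phi>_mem: "\<phi> x = u" if "u \<in> verts G" "x \<in> ?X" "x \<in> f u" for u x
  proof -
    have "f u \<in> W" using that W by (metis bij_betwE)
    then obtain z where z: "z \<in> ?X" "f u = R `` {z}" unfolding W_def by (auto elim: quotientE)
    then have "f u = R `` {x}" using that(3) equiv_class_eq[OF equiv, of z x] by auto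
    then show ?thesis using W that(1) \<phi>_def by (metis bij_betw_def the_inv_into_f_f)
  qed
  \<comment> \<open>Only complete edges are deleted, and no path edge is one.\<close>
  have path: "{(i, c), (i, Suc c)} \<in> path_edges a b - D" if "i < a" "c < b" for i c
    using that D complete_edges_iff[of i c i "Suc c"] path_edges_iff[of i c i "Suc c"] by auto
  have "grid_model G a b \<phi>"
    unfolding grid_model_def
  proof (intro conjI allI impI)
    show "\<phi> ` ?X = verts G"
    proof (intro equalityI subsetI)
      show "u \<in> verts G" if "u \<in> \<phi> ` ?X" for u using that \<phi>V by blast
      fix u assume u: "u \<in> verts G"
      then have "f u \<in> W" using W by (metis bij_betwE)
      then obtain z where z: "z \<in> ?X" "f u = R `` {z}" unfolding W_def by (auto elim: quotientE)
      then have "z \<in> f u" using equiv_class_self[OF equiv] by simp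
      then show "u \<in> \<phi> ` ?X" using \<phi>_mem[OF u z(1)] z(1) by blast
    qed
  next
    fix i j c d assume "i < a" "j < a" "c \<le> b" "d \<le> b" "\<phi> (i, c) = \<phi> (j, d)"
    then show "i = j" using \<phi>_eq[of "(i, c)" "(j, d)"] contraction_rel_row[OF S] unfolding R_def by force
  next
    fix i c d e assume h: "i < a" "d \<le> b" "c \<le> d" "\<phi> (i, c) = \<phi> (i, d)" "c \<le> e" "e \<le> d"
    then have "((i, c), (i, d)) \<in> contraction_rel S" using \<phi>_eq[of "(i, c)" "(i, d)"] R_def by simp
    \<comment> \<open>All edges between columns \<open>c\<close> and \<open>d\<close> are
      contracted, in particular those from \<open>e\<close> to \<open>d\<close>.\<close>
    then have "{(i, k), (i, Suc k)} \<in> S" if "c \<le> k" "k < d" for k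
      using contraction_rel_row[OF S] that h by fastforce
    then have "((i, e), (i, d)) \<in> R" unfolding R_def using h by (intro contraction_rel_rowI) auto
    then show "\<phi> (i, e) = \<phi> (i, d)" using \<phi>_eq[of "(i, e)" "(i, d)"] h by simp
  next
    fix i c assume h: "i < a" "c < b"
    then have X: "(i, c) \<in> ?X" "(i, Suc c) \<in> ?X" by auto
    have "{\<phi> (i, c), \<phi> (i, Suc c)} \<in> edges G" if ne: "\<phi> (i, c) \<noteq> \<phi> (i, Suc c)"
    proof -
      have "f (\<phi> (i, c)) \<noteq> f (\<phi> (i, Suc c))"
        using ne W \<phi>V[OF X(1)] \<phi>V[OF X(2)] by (metis bij_betw_def inj_onD)
      moreover have "(i, c) \<in> f (\<phi> (i, c))" "(i, Suc c) \<in> f (\<phi> (i, Suc c))"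
        using \<phi>V[OF X(1)] \<phi>V[OF X(2)] equiv_class_self[OF equiv] by auto
      moreover have "f (\<phi> (i, c)) \<in> W" "f (\<phi> (i, Suc c)) \<in> W"
        using \<phi>V[OF X(1)] \<phi>V[OF X(2)] W by (metis bij_betwE)+
      ultimately show ?thesis
        using We[of "\<phi> (i, c)" "\<phi> (i, Suc c)"] \<phi>V[OF X(1)] \<phi>V[OF X(2)] path[OF h] by blast
    qed
    then show "\<phi> (i, c) = \<phi> (i, Suc c) \<or> {\<phi> (i, c), \<phi> (i, Suc c)} \<in> edges G" by blast
  next
    fix u v assume e: "{u, v} \<in> edges G"
    note uv = edge_verts[OF G e]
    obtain C D' x y where C: "{f u, f v} = {C, D'}" "x \<in> C" "y \<in> D'"
      and "{x, y} \<in> (complete_edges a b \<union> path_edges a b) - D"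
      using iffD1[OF We[OF uv(1,2)] e] by (elim exE conjE bexE) (rule that)
    then have xy: "{x, y} \<in> complete_edges a b \<union> path_edges a b" by blast
    obtain i c j d where ij: "x = (i, c)" "y = (j, d)" by (meson prod.exhaust)
    have X: "x \<in> ?X" "y \<in> ?X"
      using xy unfolding ij by (auto simp: complete_edges_iff path_edges_iff)
    have "f u = C \<and> f v = D' \<or> f u = D' \<and> f v = C" using C(1) by (metis doubleton_eq_iff)
    then have "\<phi> x = u \<and> \<phi> y = v \<or> \<phi> x = v \<and> \<phi> y = u" using C X \<phi>_mem uv by blast
    then have img: "{u, v} = {\<phi> (i, c), \<phi> (j, d)}" using ij by blast
    show "(\<exists>i<a. \<exists>c<b. {u, v} = {\<phi> (i, c), \<phi> (i, Suc c)}) \<or>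
        (\<exists>i<a. \<exists>j<a. \<exists>c\<le>b. i \<noteq> j \<and> {u, v} = {\<phi> (i, c), \<phi> (j, c)})"
      using xy unfolding ij
    proof
      assume "{(i, c), (j, d)} \<in> complete_edges a b"
      then show ?thesis using img unfolding complete_edges_iff by blast
    next
      assume "{(i, c), (j, d)} \<in> path_edges a b"
      then have "i = j" "i < a" "d = Suc c \<and> c < b \<or> c = Suc d \<and> d < b"
        unfolding path_edges_iff by auto
      then show ?thesis using img by (metis insert_commute)
    qed
  qed
  then show ?thesis by (rule that)
qed

text \<open>Delete the complete edges whose image is not an edge of \<open>G\<close> and contract
  the path edges that \<open>\<phi>\<close> collapses. The classes are then exactly the fibres of
  \<open>\<phi>\<close>, and sending a vertex to its fibre is the isomorphism.\<close>

lemma obtainable_if_grid_model: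
  assumes G: "simple_graph G" and gm: "grid_model G a b \<phi>"
  shows "obtainable G a b"
proof -
  let ?X = "{..<a} \<times> {..b}"
  note onto = grid_modelD(1)[OF gm] and row = grid_modelD(2)[OF gm]
    and interval = grid_modelD(3)[OF gm] and step = grid_modelD(4)[OF gm]
    and edge = grid_modelD(5)[OF gm]
  define D where "D = {e \<in> complete_edges a b. \<phi> ` e \<notin> edges G}"
  define S where "S = {e \<in> path_edges a b. \<exists>v. \<phi> ` e = {v}}"
  define R where "R = contraction_rel S"
  note equiv = equiv_contraction_rel[of S, folded R_def]
  define f where "f v = {x \<in> ?X. \<phi> x = v}" for v
  have R_le: "y \<in> ?X \<and> \<phi> y = \<phi> x" if "(x, y) \<in> R" "x \<in> ?X" for x y
    using that(1) unfolding R_def contraction_rel_def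
  proof (induction rule: rtrancl_induct)
    case base
    then show ?case using that by simp
  next
    case (step y z)
    obtain i c j d where yz: "y = (i, c)" "z = (j, d)" by (meson prod.exhaust)
    have "{(i, c), (j, d)} \<in> path_edges a b" "\<exists>v. \<phi> ` {y, z} = {v}"
      using step yz unfolding S_def by auto
    then have "z \<in> ?X" "\<phi> y = \<phi> z" unfolding path_edges_iff yz by auto
    then show ?case using step by simp
  qed
  \<comment> \<open>Here the interval property enters: \<open>\<phi>\<close> is constant between
    \<open>c\<close> and \<open>d\<close>, so every edge in between is contracted.\<close>
  have R_ge': "((i, c), (i, d)) \<in> R" if "i < a" "c \<le> d" "d \<le> b" "\<phi> (i, c) = \<phi> (i, d)" for i c d
    unfolding R_def
  proof (rule contraction_rel_rowI[OF \<open>c \<le> d\<close>])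
    fix e assume e: "c \<le> e" "e < d"
    have "\<phi> (i, e) = \<phi> (i, d)" "\<phi> (i, Suc e) = \<phi> (i, d)"
      using interval[of i c d e] interval[of i c d "Suc e"] that e by auto
    moreover have "{(i, e), (i, Suc e)} \<in> path_edges a b"
      using e that by (auto simp: path_edges_iff)
    ultimately show "{(i, e), (i, Suc e)} \<in> S" unfolding S_def by auto
  qed
  have R_ge: "(x, y) \<in> R" if "x \<in> ?X" "y \<in> ?X" "\<phi> x = \<phi> y" for x y
  proof -
    obtain i c j d where xy: "x = (i, c)" "y = (j, d)" by (meson prod.exhaust)
    then have "i = j" using that row by auto
    moreover have "sym R" using equiv by (simp add: equiv_def)
    ultimately show ?thesis
      using that xy R_ge'[of i c d] R_ge'[of i d c] by (metis SigmaD1 SigmaD2 atMost_iff lessThan_iff nat_le_linear symD)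
  qed
  have cls: "R `` {x} = f (\<phi> x)" if x: "x \<in> ?X" for x
  proof (intro set_eqI iffI)
    fix y assume "y \<in> R `` {x}"
    then show "y \<in> f (\<phi> x)" using R_le[OF _ x, of y] unfolding f_def by blast
  next
    fix y assume "y \<in> f (\<phi> x)"
    then have "y \<in> ?X" "\<phi> x = \<phi> y" unfolding f_def by simp_all
    then show "y \<in> R `` {x}" using R_ge[OF x] by blast
  qed
  have W: "?X // R = f ` verts G"
  proof -
    have "?X // R = (\<lambda>x. R `` {x}) ` ?X" unfolding quotient_def by blast
    also have "\<dots> = (\<lambda>x. f (\<phi> x)) ` ?X" using cls by (rule image_cong[OF refl])
    also have "\<dots> = f ` verts G" unfolding onto[symmetric] image_image ..
    finally show ?thesis .
  qed
  have fne: "f v \<noteq> {}" if "v \<in> verts G" for v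
  proof -
    obtain x where "x \<in> ?X" "\<phi> x = v" using \<open>v \<in> verts G\<close> unfolding onto[symmetric] by blast
    then show ?thesis unfolding f_def by blast
  qed
  have finj: "u = v" if "f u = f v" "u \<in> verts G" for u v
    using fne[OF that(2)] that(1) unfolding f_def by blast
  let ?H = "contract_edges (delete_edges (grid a b) D) S"
  have vH: "verts ?H = f ` verts G"
    using W by (simp only: contract_edges_def Let_def R_def delete_edges_def verts_grid graph.sel)
  have eH: "edges ?H = {{C, D'} | C D'. C \<in> f ` verts G \<and> D' \<in> f ` verts G \<and> C \<noteq> D' \<and>
        (\<exists>x\<in>C. \<exists>y\<in>D'. {x, y} \<in> (complete_edges a b \<union> path_edges a b) - D)}"
    using W by (simp only: contract_edges_def Let_def R_def delete_edges_def verts_grid edges_grid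
        graph.sel)
  \<comment> \<open>A complete edge outside \<open>D\<close> maps to an edge by the choice of
    \<open>D\<close>; a path edge does so unless it collapses.\<close>
  have adj: "{\<phi> x, \<phi> y} \<in> edges G"
    if "{x, y} \<in> (complete_edges a b \<union> path_edges a b) - D" "\<phi> x \<noteq> \<phi> y" for x y
  proof (cases "{x, y} \<in> complete_edges a b")
    case True
    then show ?thesis using that unfolding D_def by auto
  next
    case False
    obtain i c j d where xy: "x = (i, c)" "y = (j, d)" by (meson prod.exhaust)
    then have "{(i, c), (j, d)} \<in> path_edges a b" using that False by auto
    then show ?thesis
      using step[of i c] step[of i d] that(2) unfolding path_edges_iff xy by (auto simp: insert_commute)
  qed
  have kept: "\<exists>x\<in>f u. \<exists>y\<in>f v. {x, y} \<in> (complete_edges a b \<union> path_edges a b) - D"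
    if e: "{u, v} \<in> edges G" for u v
  proof -
    have "\<exists>x\<in>?X. \<exists>y\<in>?X. {u, v} = {\<phi> x, \<phi> y} \<and> {x, y} \<in> complete_edges a b \<union> path_edges a b"
      using edge[OF e]
    proof (elim disjE exE conjE)
      fix i c assume "i < a" "c < b" "{u, v} = {\<phi> (i, c), \<phi> (i, Suc c)}"
      then show ?thesis
        by (intro bexI[of _ "(i, c)"] bexI[of _ "(i, Suc c)"]) (auto simp: path_edges_iff)
    next
      fix i j c assume "i < a" "j < a" "c \<le> b" "i \<noteq> j" "{u, v} = {\<phi> (i, c), \<phi> (j, c)}"
      then show ?thesis
        by (intro bexI[of _ "(i, c)"] bexI[of _ "(j, c)"]) (auto simp: complete_edges_iff)
    qed
    then obtain x y where xy: "x \<in> ?X" "y \<in> ?X" "{u, v} = {\<phi> x, \<phi> y}"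
      "{x, y} \<in> complete_edges a b \<union> path_edges a b" by blast
    \<comment> \<open>The grid edge found has the edge \<open>{u, v}\<close> as its image, so it was
      not deleted.\<close>
    have "\<phi> ` {x, y} \<in> edges G" using xy(3) e by simp
    then have nD: "{x, y} \<in> (complete_edges a b \<union> path_edges a b) - D"
      using xy(4) unfolding D_def by blast
    then have "{y, x} \<in> (complete_edges a b \<union> path_edges a b) - D" by (simp add: insert_commute)
    moreover have "x \<in> f u \<and> y \<in> f v \<or> x \<in> f v \<and> y \<in> f u"
      using xy unfolding f_def by (auto simp: doubleton_eq_iff)
    ultimately show ?thesis using nD by blast
  qed
  have "{u, v} \<in> edges G \<longleftrightarrow> {f u, f v} \<in> edges ?H" if uv: "u \<in> verts G" "v \<in> verts G" for u v
  proof
    assume e: "{u, v} \<in> edges G"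
    then have "f u \<noteq> f v" using finj edge_verts[OF G e] by blast
    then show "{f u, f v} \<in> edges ?H" using kept[OF e] uv unfolding eH by blast
  next
    assume "{f u, f v} \<in> edges ?H"
    then obtain C D' x y where C: "{f u, f v} = {C, D'}" "C \<noteq> D'" "x \<in> C" "y \<in> D'"
      and xy: "{x, y} \<in> (complete_edges a b \<union> path_edges a b) - D"
      unfolding eH mem_Collect_eq by (elim exE conjE bexE) (rule that)
    have "C = f u \<and> D' = f v \<or> C = f v \<and> D' = f u" using C(1) by (metis doubleton_eq_iff)
    then have "\<phi> x = u \<and> \<phi> y = v \<or> \<phi> x = v \<and> \<phi> y = u" and "u \<noteq> v"
      using C(2-4) unfolding f_def by blast+
    then have "\<phi> x \<noteq> \<phi> y" "{\<phi> x, \<phi> y} = {u, v}" by (metis, metis insert_commute)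
    then show "{u, v} \<in> edges G" using adj[OF xy] by simp
  qed
  moreover have "bij_betw f (verts G) (verts ?H)"
    unfolding vH bij_betw_def using finj by (auto intro: inj_onI)
  ultimately have "graph_isomorphic G ?H" unfolding graph_isomorphic_def by blast
  moreover have "D \<subseteq> complete_edges a b" "S \<subseteq> path_edges a b" unfolding D_def S_def by auto
  ultimately show ?thesis unfolding obtainable_def by blast
qed

theorem theorem4p1:
  fixes G :: "'a graph" and t :: nat
  assumes "simple_graph G" and "t > 0"
  shows "th_Z G \<le> enat t \<longleftrightarrow>
         (\<exists>a b :: nat. a \<ge> 1 \<and> b \<ge> 0 \<and> a + b = t \<and> obtainable G a b)"
proof
  assume "th_Z G \<le> enat t"
  then obtain \<tau> p b where s: "schedule G \<tau> p" "\<And>v. v \<in> verts G \<Longrightarrow> \<tau> v \<le> b"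
    "card (initial G \<tau>) + b = t"
    using schedule_if_th_Z_le[OF assms(1)] by metis
  \<comment> \<open>The parameter \<open>a\<close> is the number of initially blue vertices and
    \<open>b\<close> is the bound on the times.\<close>
  obtain \<phi> where "grid_model G (card (initial G \<tau>)) b \<phi>"
    using grid_model_if_schedule[OF assms(1) s(1,2)] by blast
  then have "obtainable G (card (initial G \<tau>)) b" by (rule obtainable_if_grid_model[OF assms(1)])
  then show "\<exists>a b :: nat. a \<ge> 1 \<and> b \<ge> 0 \<and> a + b = t \<and> obtainable G a b"
    using schedule_initial_nonempty[OF assms(1) s(1)] s(3) by blast
next
  assume "\<exists>a b :: nat. a \<ge> 1 \<and> b \<ge> 0 \<and> a + b = t \<and> obtainable G a b"
  then obtain a b where ab: "a + b = t" "obtainable G a b" by blast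
  obtain \<phi> where "grid_model G a b \<phi>" using grid_model_if_obtainable[OF assms(1) ab(2)] by blast
  then obtain \<tau> p where "schedule G \<tau> p" "\<And>v. v \<in> verts G \<Longrightarrow> \<tau> v \<le> b" "card (initial G \<tau>) = a"
    using schedule_if_grid_model[OF assms(1)] by metis
  then show "th_Z G \<le> enat t" using th_Z_le_if_schedule[OF assms(1)] ab(1) by metis
qed

end
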